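(* Let $r>0$, let $E_o\subseteq\mathbb{R}^n$, let $\Omega\subseteq\mathbb{R}^n$ be a bounded open set, and fix $\Omega'\Subset\Omega$. Then there exists $E\subseteq\mathbb{R}^n$ such that $E\setminus\Omega'=E_o\setminus\Omega'$ and $$\mathrm{Per}_r(E,\Omega)\le\mathrm{Per}_r(F,\Omega)$$ for any $F\subseteq\mathbb{R}^n$ for which $F\setminus\Omega'=E_o\setminus\Omega'$. The same holds for the functional $\mathcal{F}_{r,g}$, with $g\in L^1_{\rm loc}(\mathbb{R}^n)$: there exists $E\subseteq\mathbb{R}^n$ such that $E\setminus\Omega'=E_o\setminus\Omega'$ and $\mathcal{F}_{r,g}(E,\Omega)\le\mathcal{F}_{r,g}(F,\Omega)$ for any $F\subseteq\mathbb{R}^n$ for which $F\setminus\Omega'=E_o\setminus\Omega'$.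
   Context: All sets are measurable. $B_\rho(x)$ is the ball of radius $\rho$ centered at $x$ in $\mathbb{R}^n$, and $\mathcal{L}^n$ is the $n$-dimensional Lebesgue measure. For $A\subseteq\mathbb{R}^n$, $A\oplus B_r:=\bigcup_{x\in A}B_r(x)$. Measurable sets are identified with their sets of points of density one (so equalities of sets are up to null sets), and $\partial E$ denotes the topological boundary of the set of points of density one of $E$. For a domain $\Omega$, measurable $E\subseteq\mathbb{R}^n$ and $g\in L^1_{\rm loc}(\mathbb{R}^n)$, $$\mathrm{Per}_r(E,\Omega):=\frac{1}{2r}\mathcal{L}^n\Big(\big((\partial E)\oplus B_r\big)\cap\Omega\Big),\qquad \mathcal{F}_{r,g}(E,\Omega):=\mathrm{Per}_r(E,\Omega)+\int_{E\cap\Omega}g(x)\,dx .$$ *)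

theory Defs
  imports "HOL-Analysis.Analysis"
begin

text \<open>
  Measurable sets are handled up to null sets: a Lebesgue set is represented by an arbitrary
  member of its class, equality of sets is \<open>ae_eq\<close>, and the boundary is taken of the canonical
  representative \<open>density_points\<close>, so it depends only on the class.
\<close>

definition ae_eq :: "'a::euclidean_space set \<Rightarrow> 'a set \<Rightarrow> bool" where
  "ae_eq A B \<longleftrightarrow> (A - B) \<union> (B - A) \<in> null_sets lebesgue"

definition density_points :: "'a::euclidean_space set \<Rightarrow> 'a set" where
  "density_points E =
     {x. ((\<lambda>\<rho>. measure lebesgue (E \<inter> ball x \<rho>) / measure lebesgue (ball x \<rho>)) \<longlongrightarrow> 1) (at_right 0)}"

definition ess_boundary :: "'a::euclidean_space set \<Rightarrow> 'a set" where
  "ess_boundary E = frontier (density_points E)"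

definition ball_sum :: "'a::euclidean_space set \<Rightarrow> real \<Rightarrow> 'a set" where
  "ball_sum A r = (\<Union>x\<in>A. ball x r)"

text \<open>
  The next two functionals are real-valued and meant for bounded open \<open>\<Omega>\<close>. There the measure in
  \<open>Per\<close> is that of a bounded open set, hence finite, and a locally integrable \<open>g\<close> is integrable on
  \<open>E \<inter> \<Omega>\<close>; so neither \<open>measure\<close> nor the integral takes its default value.
\<close>

definition Per :: "real \<Rightarrow> 'a::euclidean_space set \<Rightarrow> 'a set \<Rightarrow> real" where
  "Per r E \<Omega> = 1 / (2 * r) * measure lebesgue (ball_sum (ess_boundary E) r \<inter> \<Omega>)"

definition Per_plus :: "real \<Rightarrow> ('a::euclidean_space \<Rightarrow> real) \<Rightarrow> 'a set \<Rightarrow> 'a set \<Rightarrow> real" where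
  "Per_plus r g E \<Omega> = Per r E \<Omega> + (LINT x:(E \<inter> \<Omega>)|lebesgue. g x)"

definition locally_integrable :: "('a::euclidean_space \<Rightarrow> real) \<Rightarrow> bool" where
  "locally_integrable g \<longleftrightarrow> (\<forall>K. compact K \<longrightarrow> set_integrable lebesgue K g)"

definition compactly_inside :: "'a::euclidean_space set \<Rightarrow> 'a set \<Rightarrow> bool" where
  "compactly_inside A B \<longleftrightarrow> compact (closure A) \<and> closure A \<subseteq> B"

end

theory Submission
  imports Defs "HOL-Library.Diagonal_Subsequence"
begin

text \<open>
  The proof is the direct method, with a compactness argument that replaces strong convergence in
  \<open>L\<^sup>1\<close>. The obstacle is that a bound on \<open>Per r\<close> gives no such compactness: the sets \<open>G\<^sub>k\<close> of a
  minimizing sequence may oscillate faster and faster. But rapid oscillation in a region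
  fills that region with boundary points, and once they are there, changing the set inside the
  region costs no additional perimeter.

  Accordingly, pass to a subsequence for which, on each member of a countable basis of connected
  open sets, \<open>G\<^sub>k\<close> is either eventually null, or eventually of full measure, or eventually neither
  (\<open>subsequence_limit_phases\<close>). The first two kinds of basis sets fill two disjoint open phases
  \<open>N\<close> and \<open>P\<close>, on which \<open>G\<^sub>k\<close> converges almost everywhere to the empty and to the full set. By the
  Lebesgue density theorem a connected open set on which \<open>G\<^sub>k\<close> is neither null nor full contains an
  essential boundary point of \<open>G\<^sub>k\<close>; hence every point of the remaining closed set
  \<open>C = - (N \<union> P)\<close> is a limit of essential boundary points of the \<open>G\<^sub>k\<close>.

  The minimizer \<open>E\<close> contains \<open>P\<close>, avoids \<open>N\<close> (both up to null sets), agrees with the datum outside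
  \<open>\<Omega>'\<close>, and inside \<open>C \<inter> \<Omega>'\<close> it is \<open>{g < 0}\<close>, the choice that is pointwise optimal for the bulk term. Its essential
  boundary lies in \<open>C\<close>, so each point within distance less than \<open>r\<close> of it is eventually within
  distance less than \<open>r\<close> of the essential boundary of \<open>G\<^sub>k\<close>. Thus the integrand of the functional at \<open>E\<close> is almost
  everywhere eventually bounded by that at \<open>G\<^sub>k\<close>, and dominated convergence gives minimality
  (\<open>Per_plus_minimizer\<close>). The statement for \<open>Per\<close> is the case \<open>g = 0\<close>.
\<close>

section \<open>The Lebesgue density theorem\<close>

text \<open>
  Cover \<open>F\<close> by an open set \<open>V\<close> with \<open>V - F\<close> of measure less than \<open>e / c\<close>. The balls in \<open>V\<close> in which
  \<open>V - F\<close> occupies at least the fraction \<open>1 / c\<close> form a Vitali cover of the set in question, and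
  disjoint balls of this kind have total measure at most \<open>c\<close> times that of \<open>V - F\<close>.
\<close>

lemma negligible_points_of_thick_complement:
  fixes F :: "'a::euclidean_space set"
  assumes F: "F \<in> sets lebesgue" and c: "c > 0"
  shows "negligible {x \<in> F. \<forall>d>0. \<exists>\<rho>. 0 < \<rho> \<and> \<rho> < d \<and>
           measure lebesgue (ball x \<rho>) \<le> c * measure lebesgue (ball x \<rho> - F)}"
    (is "negligible ?S")
  unfolding negligible_outer
proof (intro allI impI)
  fix e :: real assume e: "e > 0"
  obtain V where V: "open V" "F \<subseteq> V" "V - F \<in> lmeasurable"
      and VF: "emeasure lebesgue (V - F) < ennreal (e / c)"
    using sets_lebesgue_outer_open[OF F, of "e / c"] divide_pos_pos[OF e c] by metis
  define K where "K = {(x, \<rho>). x \<in> F \<and> 0 < \<rho> \<and> ball x \<rho> \<subseteq> V \<and>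
           measure lebesgue (ball x \<rho>) \<le> c * measure lebesgue (ball x \<rho> - F)}"
  have cover: "\<exists>i. i \<in> K \<and> x \<in> ball (fst i) (snd i) \<and> snd i < d" if x: "x \<in> ?S" and d: "0 < d" for x d
  proof -
    obtain d' where d': "d' > 0" "ball x d' \<subseteq> V"
      using x V openE by blast
    obtain \<rho> where "0 < \<rho>" "\<rho> < min d d'"
        "measure lebesgue (ball x \<rho>) \<le> c * measure lebesgue (ball x \<rho> - F)"
      using x d d' by (auto dest!: spec[of _ "min d d'"])
    then have "(x, \<rho>) \<in> K" "\<rho> < d"
      using x d' unfolding K_def by auto
    then show ?thesis using \<open>0 < \<rho>\<close> by force
  qed
  obtain C where C: "countable C" "C \<subseteq> K"
      and disj: "pairwise (\<lambda>i j. disjnt (ball (fst i) (snd i)) (ball (fst j) (snd j))) C"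
      and neg: "negligible (?S - (\<Union>i\<in>C. ball (fst i) (snd i)))"
    by (rule Vitali_covering_theorem_balls[of ?S K fst snd]) (use cover in blast)+
  define B where "B i = ball (fst i) (snd i)" for i :: "'a \<times> real"
  have BF[measurable]: "B i \<in> sets lebesgue" "B i - F \<in> sets lebesgue" for i
    using F by (auto simp: B_def)
  have dB: "disjoint_family_on B C"
    using disj by (simp add: disjoint_family_on_def pairwise_def disjnt_def B_def)
  then have dBF: "disjoint_family_on (\<lambda>i. B i - F) C"
    unfolding disjoint_family_on_def by blast
  have each: "emeasure lebesgue (B i) \<le> ennreal c * emeasure lebesgue (B i - F)" if "i \<in> C" for i
  proof -
    have lm: "B i \<in> lmeasurable" "B i - F \<in> lmeasurable"
      using F by (auto simp: B_def intro: fmeasurable.Diff fmeasurable_Diff)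
    have "measure lebesgue (B i) \<le> c * measure lebesgue (B i - F)"
      using that C(2) by (auto simp: K_def B_def)
    then show ?thesis
      using lm c by (simp add: emeasure_eq_measure2 flip: ennreal_mult)
  qed
  have "emeasure lebesgue (\<Union>i\<in>C. B i) = (\<integral>\<^sup>+i. emeasure lebesgue (B i) \<partial>count_space C)"
    by (intro emeasure_UN_countable C dB) auto
  also have "\<dots> \<le> (\<integral>\<^sup>+i. ennreal c * emeasure lebesgue (B i - F) \<partial>count_space C)"
    by (intro nn_integral_mono) (use each in auto)
  also have "\<dots> = ennreal c * (\<integral>\<^sup>+i. emeasure lebesgue (B i - F) \<partial>count_space C)"
    by (intro nn_integral_cmult) auto
  also have "(\<integral>\<^sup>+i. emeasure lebesgue (B i - F) \<partial>count_space C) = emeasure lebesgue (\<Union>i\<in>C. B i - F)"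
    by (intro emeasure_UN_countable[symmetric] C dBF) auto
  also have "\<dots> \<le> emeasure lebesgue (V - F)"
  proof (intro emeasure_mono)
    have "B i \<subseteq> V" if "i \<in> C" for i
      using subsetD[OF C(2) that] by (auto simp: K_def B_def)
    then show "(\<Union>i\<in>C. B i - F) \<subseteq> V - F" by blast
  qed (use V in auto)
  finally have "emeasure lebesgue (\<Union>i\<in>C. B i) \<le> ennreal c * emeasure lebesgue (V - F)"
    by (simp add: mult_left_mono)
  also have "\<dots> < ennreal c * ennreal (e / c)"
    using VF c by (intro ennreal_mult_strict_left_mono) auto
  also have "\<dots> = ennreal e"
    using c e by (simp flip: ennreal_mult)
  finally have small: "emeasure lebesgue (\<Union>i\<in>C. B i) < ennreal e" .
  have UC: "(\<Union>i\<in>C. B i) \<in> sets lebesgue"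
    using C by (intro sets.countable_UN'') auto
  let ?N = "?S - (\<Union>i\<in>C. B i)"
  have N: "?N \<in> null_sets lebesgue"
    using neg by (simp add: negligible_iff_null_sets B_def)
  have em: "emeasure lebesgue ((\<Union>i\<in>C. B i) \<union> ?N) < ennreal e"
    using small emeasure_Un_null_set[OF UC N] by simp
  then have lm: "(\<Union>i\<in>C. B i) \<union> ?N \<in> lmeasurable"
    using sets.Un[OF UC null_setsD2[OF N]] less_trans[OF em ennreal_less_top]
    by (intro fmeasurableI) simp_all
  then have "measure lebesgue ((\<Union>i\<in>C. B i) \<union> ?N) < e"
    using em e by (simp add: emeasure_eq_measure2 ennreal_less_iff)
  then show "\<exists>T. ?S \<subseteq> T \<and> T \<in> lmeasurable \<and> measure lebesgue T < e"
    using lm by (intro exI[of _ "(\<Union>i\<in>C. B i) \<union> ?N"]) auto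
qed

lemma measure_Int_plus_Diff_ball:
  fixes F :: "'a::euclidean_space set"
  assumes "F \<in> sets lebesgue"
  shows "measure lebesgue (F \<inter> ball x \<rho>) + measure lebesgue (ball x \<rho> - F) = measure lebesgue (ball x \<rho>)"
proof -
  have "ball x \<rho> \<inter> F \<in> lmeasurable" "ball x \<rho> - F \<in> lmeasurable"
    using assms by (auto intro: fmeasurable_Int_fmeasurable fmeasurable_Diff)
  then have "measure lebesgue (ball x \<rho> \<inter> F) + measure lebesgue (ball x \<rho> - F)
      = measure lebesgue ((ball x \<rho> \<inter> F) \<union> (ball x \<rho> - F))"
    by (intro measure_Un_AE[symmetric]) auto
  also have "(ball x \<rho> \<inter> F) \<union> (ball x \<rho> - F) = ball x \<rho>" by auto
  finally show ?thesis by (simp add: Int_commute)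
qed

text \<open>
  If the density of \<open>F\<close> at \<open>x\<close> is not 1, then for some \<open>n\<close> there are arbitrarily small balls around
  \<open>x\<close> in which the complement of \<open>F\<close> occupies a fraction of at least \<open>1 / (n + 1)\<close>.
\<close>

theorem lebesgue_density:
  fixes F :: "'a::euclidean_space set"
  assumes F: "F \<in> sets lebesgue"
  shows "negligible (F - density_points F)"
proof (rule negligible_subset)
  let ?S = "\<lambda>c. {x \<in> F. \<forall>d>0. \<exists>\<rho>. 0 < \<rho> \<and> \<rho> < d \<and>
           measure lebesgue (ball x \<rho>) \<le> c * measure lebesgue (ball x \<rho> - F)}"
  show "negligible (\<Union>n::nat. ?S (real (Suc n)))"
    by (intro negligible_Union_nat negligible_points_of_thick_complement F) auto
  show "F - density_points F \<subseteq> (\<Union>n::nat. ?S (real (Suc n)))"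
  proof
    fix x assume x: "x \<in> F - density_points F"
    let ?q = "\<lambda>\<rho>. measure lebesgue (F \<inter> ball x \<rho>) / measure lebesgue (ball x \<rho>)"
    obtain \<epsilon> where \<epsilon>: "\<epsilon> > 0" "\<not> (\<forall>\<^sub>F \<rho> in at_right 0. dist (?q \<rho>) 1 < \<epsilon>)"
      using x by (auto simp: density_points_def tendsto_iff)
    obtain n where n: "1 / real (Suc n) < \<epsilon>"
      using \<epsilon>(1) nat_approx_posE by blast
    have "\<exists>\<rho>. 0 < \<rho> \<and> \<rho> < d \<and>
        measure lebesgue (ball x \<rho>) \<le> real (Suc n) * measure lebesgue (ball x \<rho> - F)" if d: "d > 0" for d
    proof -
      obtain \<rho> where \<rho>: "0 < \<rho>" "\<rho> < d" "\<not> dist (?q \<rho>) 1 < \<epsilon>"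
        using \<epsilon>(2) d unfolding eventually_at_right_field by blast
      have pos: "measure lebesgue (ball x \<rho>) > 0"
        using content_ball_pos[OF \<rho>(1), of x] by simp
      have "?q \<rho> = 1 - measure lebesgue (ball x \<rho> - F) / measure lebesgue (ball x \<rho>)"
        using measure_Int_plus_Diff_ball[OF F, of x \<rho>] pos by (simp add: field_simps)
      then have "dist (?q \<rho>) 1 = measure lebesgue (ball x \<rho> - F) / measure lebesgue (ball x \<rho>)"
        by (simp add: dist_real_def)
      then have "1 / real (Suc n) \<le> measure lebesgue (ball x \<rho> - F) / measure lebesgue (ball x \<rho>)"
        using \<rho>(3) n by linarith
      then have "measure lebesgue (ball x \<rho>) \<le> real (Suc n) * measure lebesgue (ball x \<rho> - F)"
        using pos by (simp add: field_simps)
      with \<rho> show ?thesis by blast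
    qed
    with x show "x \<in> (\<Union>n::nat. ?S (real (Suc n)))" by blast
  qed
qed

section \<open>Locating the essential boundary\<close>

lemma density_points_disjoint_open:
  fixes E U :: "'a::euclidean_space set"
  assumes "open U" "negligible (U \<inter> E)"
  shows "U \<inter> density_points E = {}"
proof (rule equals0I)
  fix x assume x: "x \<in> U \<inter> density_points E"
  obtain d where d: "d > 0" "ball x d \<subseteq> U"
    using x assms(1) openE by blast
  let ?q = "\<lambda>\<rho>. measure lebesgue (E \<inter> ball x \<rho>) / measure lebesgue (ball x \<rho>)"
  have "?q \<rho> = 0" if "0 < \<rho>" "\<rho> < d" for \<rho>
  proof -
    have "negligible (E \<inter> ball x \<rho>)"
      by (rule negligible_subset[OF assms(2)]) (use d that in auto)
    then show ?thesis by (simp add: negligible_imp_measure0)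
  qed
  then have "\<forall>\<^sub>F \<rho> in at_right 0. ?q \<rho> = 0"
    unfolding eventually_at_right_field using d by blast
  then have "(?q \<longlongrightarrow> 0) (at_right 0)"
    by (rule tendsto_eventually)
  moreover have "(?q \<longlongrightarrow> 1) (at_right 0)"
    using x by (simp add: density_points_def)
  ultimately show False
    using tendsto_unique[of "at_right (0::real)"] by fastforce
qed

lemma open_subset_density_points:
  fixes E U :: "'a::euclidean_space set"
  assumes "open U" "negligible (U - E)" "E \<in> sets lebesgue"
  shows "U \<subseteq> density_points E"
proof
  fix x assume x: "x \<in> U"
  obtain d where d: "d > 0" "ball x d \<subseteq> U"
    using x assms(1) openE by blast
  let ?q = "\<lambda>\<rho>. measure lebesgue (E \<inter> ball x \<rho>) / measure lebesgue (ball x \<rho>)"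
  have "?q \<rho> = 1" if "0 < \<rho>" "\<rho> < d" for \<rho>
  proof -
    have "negligible (ball x \<rho> - E)"
      by (rule negligible_subset[OF assms(2)]) (use d that in auto)
    then have "measure lebesgue (ball x \<rho> - E) = 0" by (simp add: negligible_imp_measure0)
    then show ?thesis
      using measure_Int_plus_Diff_ball[OF assms(3), of x \<rho>] content_ball_pos[OF that(1), of x]
      by simp
  qed
  then have "\<forall>\<^sub>F \<rho> in at_right 0. ?q \<rho> = 1"
    unfolding eventually_at_right_field using d by blast
  then show "x \<in> density_points E"
    unfolding density_points_def by (auto intro: tendsto_eventually)
qed

lemma ess_boundary_disjoint_open:
  fixes E U :: "'a::euclidean_space set"
  assumes "open U" "E \<in> sets lebesgue" "negligible (U \<inter> E) \<or> negligible (U - E)"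
  shows "U \<inter> ess_boundary E = {}"
  using assms(3)
proof
  assume "negligible (U \<inter> E)"
  then have "U \<inter> density_points E = {}"
    using assms density_points_disjoint_open by blast
  then have "U \<inter> closure (density_points E) = {}"
    using assms(1) open_Int_closure_eq_empty by blast
  then show ?thesis by (auto simp: ess_boundary_def frontier_def)
next
  assume "negligible (U - E)"
  then have "U \<subseteq> interior (density_points E)"
    using assms by (intro interior_maximal open_subset_density_points)
  then show ?thesis by (auto simp: ess_boundary_def frontier_def)
qed

text \<open>
  A connected set that misses the topological boundary of \<open>density_points E\<close> lies inside
  \<open>density_points E\<close> or outside it. By the density theorem, applied to \<open>- E\<close> and to \<open>E\<close> respectively,
  \<open>E\<close> would then be full or null in \<open>U\<close>.
\<close>

lemma ess_boundary_meets_connected: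
  fixes E U :: "'a::euclidean_space set"
  assumes "connected U" "E \<in> sets lebesgue"
    and "\<not> negligible (U \<inter> E)" "\<not> negligible (U - E)"
  shows "U \<inter> ess_boundary E \<noteq> {}"
proof -
  have "U \<inter> density_points E \<noteq> {}"
  proof
    assume "U \<inter> density_points E = {}"
    then have "U \<inter> E \<subseteq> E - density_points E" by auto
    then show False
      using lebesgue_density[OF assms(2)] assms(3) negligible_subset by blast
  qed
  moreover have "U - density_points E \<noteq> {}"
  proof
    assume "U - density_points E = {}"
    moreover have "density_points E \<inter> density_points (- E) = {}"
    proof (rule equals0I)
      fix x assume x: "x \<in> density_points E \<inter> density_points (- E)"
      let ?q = "\<lambda>E \<rho>. measure lebesgue (E \<inter> ball x \<rho>) / measure lebesgue (ball x \<rho>)"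
      have "((\<lambda>\<rho>. ?q E \<rho> + ?q (- E) \<rho>) \<longlongrightarrow> 1 + 1) (at_right 0)"
        using x by (intro tendsto_add) (auto simp: density_points_def)
      moreover have "\<forall>\<^sub>F \<rho> in at_right 0. ?q E \<rho> + ?q (- E) \<rho> = 1"
      proof -
        have "?q E \<rho> + ?q (- E) \<rho> = 1" if "0 < \<rho>" for \<rho>
        proof -
          have "- E \<inter> ball x \<rho> = ball x \<rho> - E" by auto
          then show ?thesis
            using measure_Int_plus_Diff_ball[OF assms(2), of x \<rho>] content_ball_pos[OF that, of x]
            by (simp flip: add_divide_distrib)
        qed
        then show ?thesis
          unfolding eventually_at_right_field by (auto intro: exI[of _ 1])
      qed
      then have "((\<lambda>\<rho>. ?q E \<rho> + ?q (- E) \<rho>) \<longlongrightarrow> 1) (at_right 0)"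
        by (rule tendsto_eventually)
      ultimately show False
        using tendsto_unique[of "at_right (0::real)"] by fastforce
    qed
    ultimately have "U - E \<subseteq> (- E) - density_points (- E)" by auto
    moreover have "- E \<in> sets lebesgue"
      using assms(2) by (simp add: Compl_in_sets_lebesgue)
    ultimately show False
      using lebesgue_density assms(4) negligible_subset by blast
  qed
  ultimately show ?thesis
    using connected_Int_frontier[OF assms(1)] by (auto simp: ess_boundary_def)
qed

section \<open>Limit phases of a sequence of sets\<close>

text \<open>
  Sequential compactness of the space of 0-1 sequences, in logical form.
\<close>

lemma subsequence_deciding_predicates:
  fixes Q :: "nat \<Rightarrow> nat \<Rightarrow> bool"
  obtains s :: "nat \<Rightarrow> nat" where "strict_mono s"
    "\<And>n. (\<forall>\<^sub>F k in sequentially. Q n (s k)) \<or> (\<forall>\<^sub>F k in sequentially. \<not> Q n (s k))"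
proof -
  define P where "P n s \<longleftrightarrow> (\<forall>\<^sub>F k in sequentially. Q n (s k)) \<or>
      (\<forall>\<^sub>F k in sequentially. \<not> Q n (s k))" for n and s :: "nat \<Rightarrow> nat"
  have ex: "\<exists>r. strict_mono r \<and> P n (s \<circ> r)" for n and s :: "nat \<Rightarrow> nat"
  proof (cases "\<exists>\<^sub>F k in sequentially. Q n (s k)")
    case True
    then have inf: "infinite {k. Q n (s k)}"
      by (simp add: frequently_cofinite flip: cofinite_eq_sequentially)
    then obtain r :: "nat \<Rightarrow> nat" where "strict_mono r" "\<And>k. r k \<in> {k. Q n (s k)}"
      using infinite_enumerate by blast
    then show ?thesis by (intro exI[of _ r]) (auto simp: P_def)
  next
    case False
    then show ?thesis
      by (intro exI[of _ id]) (auto simp: P_def frequently_def strict_mono_id)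
  qed
  interpret subseqs P by unfold_locales (rule ex)
  have stable: "P n (s \<circ> r)" if "strict_mono r" "P n s" for r s :: "nat \<Rightarrow> nat" and n
    using that eventually_subseq[OF that(1)] unfolding P_def by (auto intro: eventually_subseq)
  have "P n diagseq" for n
  proof -
    have "P n (diagseq \<circ> ((+) (Suc n)))"
      by (rule diagseq_holds) (rule stable)
    then show ?thesis
      using eventually_sequentially_seg[of _ "Suc n"]
      by (auto simp: P_def add.commute)
  qed
  then show ?thesis
    using that subseq_diagseq by (auto simp: P_def)
qed

text \<open>
  Connectedness is what makes the basis detect essential boundary points through
  \<open>ess_boundary_meets_connected\<close>; an arbitrary countable basis would not do.
\<close>

lemma countable_connected_basis:
  obtains U :: "nat \<Rightarrow> 'a::euclidean_space set"
  where "\<And>j. open (U j)" "\<And>j. connected (U j)"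
    "\<And>W x. open W \<Longrightarrow> x \<in> W \<Longrightarrow> \<exists>j. x \<in> U j \<and> U j \<subseteq> W"
proof -
  obtain D :: "'a set" where D: "countable D" "\<And>X. open X \<Longrightarrow> X \<noteq> {} \<Longrightarrow> \<exists>d\<in>D. d \<in> X"
    using countable_dense_exists by blast
  have "D \<noteq> {}" using D(2)[of UNIV] by auto
  define \<B> where "\<B> = (\<lambda>(d, n). ball d (1 / real (Suc n))) ` (D \<times> (UNIV :: nat set))"
  have B: "countable \<B>" "\<B> \<noteq> {}"
    using D(1) \<open>D \<noteq> {}\<close> by (auto simp: \<B>_def)
  have sub: "\<exists>V\<in>\<B>. x \<in> V \<and> V \<subseteq> W" if "open W" "x \<in> W" for W x
  proof -
    obtain e where e: "e > 0" "ball x e \<subseteq> W"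
      using \<open>open W\<close> \<open>x \<in> W\<close> openE by blast
    obtain n where n: "1 / real (Suc n) < e / 2"
      using e(1) nat_approx_posE[of "e / 2"] by auto
    obtain d where d: "d \<in> D" "d \<in> ball x (1 / real (Suc n))"
      using D(2)[of "ball x (1 / real (Suc n))"] by auto
    have "ball d (1 / real (Suc n)) \<subseteq> ball x e"
    proof
      fix y assume "y \<in> ball d (1 / real (Suc n))"
      then show "y \<in> ball x e"
        using d(2) n dist_triangle[of x y d] by (simp only: mem_ball)
    qed
    moreover have "x \<in> ball d (1 / real (Suc n))"
      using d(2) by (simp only: mem_ball dist_commute)
    moreover have "ball d (1 / real (Suc n)) \<in> \<B>"
      using d(1) unfolding \<B>_def by force
    ultimately show ?thesis using e(2) by blast
  qed
  have in_B: "from_nat_into \<B> j \<in> \<B>" for j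
    using B from_nat_into by blast
  show ?thesis
  proof (rule that[of "from_nat_into \<B>"])
    show "open (from_nat_into \<B> j)" "connected (from_nat_into \<B> j)" for j
      using in_B[of j] by (auto simp: \<B>_def)
    show "\<exists>j. x \<in> from_nat_into \<B> j \<and> from_nat_into \<B> j \<subseteq> W" if "open W" "x \<in> W" for W x
      using sub[OF that] from_nat_into_surj[OF B(1)] by metis
  qed
qed

lemma negligible_if_AE_not_in:
  assumes "AE x in lebesgue. x \<notin> A" "A \<in> sets lebesgue"
  shows "negligible A"
  using assms AE_iff_null_sets[of A lebesgue] by (simp add: negligible_iff_null_sets)

text \<open>
  The substitute for compactness: \<open>N\<close> and \<open>P\<close> are the regions where the subsequence becomes locally
  null and locally full, and the essential boundaries accumulate at every other point.
  For ever finer oscillations both \<open>N\<close> and \<open>P\<close> are empty.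
\<close>

lemma subsequence_limit_phases:
  fixes F :: "nat \<Rightarrow> 'a::euclidean_space set"
  assumes F: "\<And>k. F k \<in> sets lebesgue"
  obtains s :: "nat \<Rightarrow> nat" and N P :: "'a set"
  where "strict_mono s" "open N" "open P" "N \<inter> P = {}"
    "AE x in lebesgue. x \<in> N \<longrightarrow> (\<forall>\<^sub>F k in sequentially. x \<notin> F (s k))"
    "AE x in lebesgue. x \<in> P \<longrightarrow> (\<forall>\<^sub>F k in sequentially. x \<in> F (s k))"
    "\<forall>x e. x \<notin> N \<union> P \<longrightarrow> e > 0 \<longrightarrow>
       (\<forall>\<^sub>F k in sequentially. ball x e \<inter> ess_boundary (F (s k)) \<noteq> {})"
proof -
  obtain U :: "nat \<Rightarrow> 'a set" where opU: "\<And>j. open (U j)" and conU: "\<And>j. connected (U j)"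
      and bas: "\<And>W x. open W \<Longrightarrow> x \<in> W \<Longrightarrow> \<exists>j. x \<in> U j \<and> U j \<subseteq> W"
    using countable_connected_basis by blast
  \<comment> \<open>Even indices ask whether a basis set is null, odd ones whether it is full.\<close>
  define Q where "Q n k \<longleftrightarrow> negligible
      (if even n then U (n div 2) \<inter> F k else U (n div 2) - F k)" for n k
  obtain s where s: "strict_mono s"
      and dec: "\<And>n. (\<forall>\<^sub>F k in sequentially. Q n (s k)) \<or> (\<forall>\<^sub>F k in sequentially. \<not> Q n (s k))"
    using subsequence_deciding_predicates[of Q] by blast
  define null where "null j k \<longleftrightarrow> negligible (U j \<inter> F (s k))" for j k
  define full where "full j k \<longleftrightarrow> negligible (U j - F (s k))" for j k
  have null: "(\<forall>\<^sub>F k in sequentially. null j k) \<or> (\<forall>\<^sub>F k in sequentially. \<not> null j k)" for j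
    using dec[of "2 * j"] by (simp add: Q_def null_def)
  have full: "(\<forall>\<^sub>F k in sequentially. full j k) \<or> (\<forall>\<^sub>F k in sequentially. \<not> full j k)" for j
    using dec[of "2 * j + 1"] by (simp add: Q_def full_def)
  define N where "N = (\<Union>j\<in>{j. \<forall>\<^sub>F k in sequentially. null j k}. U j)"
  define P where "P = (\<Union>j\<in>{j. \<forall>\<^sub>F k in sequentially. full j k}. U j)"
  have aeN: "AE x in lebesgue. x \<in> N \<longrightarrow> (\<forall>\<^sub>F k in sequentially. x \<notin> F (s k))"
  proof -
    have "AE x in lebesgue. null j k \<longrightarrow> x \<in> U j \<longrightarrow> x \<notin> F (s k)" for j k
    proof (cases "null j k")
      case True
      then have "U j \<inter> F (s k) \<in> null_sets lebesgue"
        by (simp add: null_def negligible_iff_null_sets)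
      from AE_not_in[OF this] show ?thesis by eventually_elim auto
    qed simp
    then have "AE x in lebesgue. \<forall>j k. null j k \<longrightarrow> x \<in> U j \<longrightarrow> x \<notin> F (s k)"
      by (simp add: AE_all_countable)
    then show ?thesis
    proof eventually_elim
      case (elim x)
      show ?case
      proof
        assume "x \<in> N"
        then obtain j where "x \<in> U j" "\<forall>\<^sub>F k in sequentially. null j k" by (auto simp: N_def)
        then show "\<forall>\<^sub>F k in sequentially. x \<notin> F (s k)"
          using elim by (auto elim!: eventually_mono)
      qed
    qed
  qed
  have aeP: "AE x in lebesgue. x \<in> P \<longrightarrow> (\<forall>\<^sub>F k in sequentially. x \<in> F (s k))"
  proof -
    have "AE x in lebesgue. full j k \<longrightarrow> x \<in> U j \<longrightarrow> x \<in> F (s k)" for j k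
    proof (cases "full j k")
      case True
      then have "U j - F (s k) \<in> null_sets lebesgue"
        by (simp add: full_def negligible_iff_null_sets)
      from AE_not_in[OF this] show ?thesis by eventually_elim auto
    qed simp
    then have "AE x in lebesgue. \<forall>j k. full j k \<longrightarrow> x \<in> U j \<longrightarrow> x \<in> F (s k)"
      by (simp add: AE_all_countable)
    then show ?thesis
    proof eventually_elim
      case (elim x)
      show ?case
      proof
        assume "x \<in> P"
        then obtain j where "x \<in> U j" "\<forall>\<^sub>F k in sequentially. full j k" by (auto simp: P_def)
        then show "\<forall>\<^sub>F k in sequentially. x \<in> F (s k)"
          using elim by (auto elim!: eventually_mono)
      qed
    qed
  qed
  have op: "open N" "open P" using opU by (auto simp: N_def P_def)
  have "AE x in lebesgue. x \<notin> N \<inter> P"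
    using aeN aeP
  proof eventually_elim
    case (elim x)
    show ?case
    proof
      assume "x \<in> N \<inter> P"
      with elim have "\<forall>\<^sub>F k in sequentially. x \<notin> F (s k)" "\<forall>\<^sub>F k in sequentially. x \<in> F (s k)"
        by auto
      from eventually_conj[OF this] show False by simp
    qed
  qed
  then have "negligible (N \<inter> P)"
    by (rule negligible_if_AE_not_in) (use op in auto)
  then have disj: "N \<inter> P = {}"
    using op open_not_negligible[of "N \<inter> P"] by blast
  have bd: "\<forall>\<^sub>F k in sequentially. ball x e \<inter> ess_boundary (F (s k)) \<noteq> {}"
    if x: "x \<notin> N \<union> P" and e: "e > 0" for x e
  proof -
    obtain j where j: "x \<in> U j" "U j \<subseteq> ball x e"
      using bas[of "ball x e" x] e by auto
    have "\<forall>\<^sub>F k in sequentially. \<not> null j k" "\<forall>\<^sub>F k in sequentially. \<not> full j k"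
      using x j(1) null[of j] full[of j] by (auto simp: N_def P_def)
    then show ?thesis
    proof eventually_elim
      case (elim k)
      then have "U j \<inter> ess_boundary (F (s k)) \<noteq> {}"
        using ess_boundary_meets_connected[OF conU F] by (simp add: null_def full_def)
      then show ?case using j by blast
    qed
  qed
  show ?thesis using that[OF s op disj aeN aeP] bd by blast
qed

section \<open>Existence of minimizers\<close>

text \<open>
  A one-sided form of dominated convergence: \<open>min (f x) (h k x)\<close> is, for almost every \<open>x\<close>,
  eventually equal to \<open>f x\<close>, and it never exceeds \<open>h k x\<close>.
\<close>

lemma integral_le_limit_if_eventually_le:
  fixes f :: "'a \<Rightarrow> real"
  assumes w: "integrable M w" and f: "f \<in> borel_measurable M" "\<And>x. \<bar>f x\<bar> \<le> w x"
    and h: "\<And>k. h k \<in> borel_measurable M" "\<And>k x. \<bar>h k x\<bar> \<le> w x"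
    and le: "AE x in M. \<forall>\<^sub>F k in sequentially. f x \<le> h k x"
    and lim: "(\<lambda>k. integral\<^sup>L M (h k)) \<longlonglongrightarrow> L"
  shows "integral\<^sup>L M f \<le> L"
proof (rule LIMSEQ_le)
  show "(\<lambda>k. LINT x|M. min (f x) (h k x)) \<longlonglongrightarrow> integral\<^sup>L M f"
  proof (rule integral_dominated_convergence[OF _ _ w])
    show "AE x in M. (\<lambda>k. min (f x) (h k x)) \<longlonglongrightarrow> f x"
      using le
    proof eventually_elim
      case (elim x)
      then have "\<forall>\<^sub>F k in sequentially. min (f x) (h k x) = f x"
        by eventually_elim simp
      then show ?case by (rule tendsto_eventually)
    qed
    show "AE x in M. norm (min (f x) (h k x)) \<le> w x" for k
      using f(2) h(2)[of k] by (auto simp: min_def)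
  qed (use f h in auto)
  show "(\<lambda>k. integral\<^sup>L M (h k)) \<longlonglongrightarrow> L" by (rule lim)
  have int: "integrable M (h k)" for k
    by (rule Bochner_Integration.integrable_bound[OF w]) (use h in \<open>auto intro!: AE_I2 order_trans[OF _ abs_ge_self]\<close>)
  have "integrable M f"
    by (rule Bochner_Integration.integrable_bound[OF w]) (use f in \<open>auto intro!: AE_I2 order_trans[OF _ abs_ge_self]\<close>)
  then have "(LINT x|M. min (f x) (h k x)) \<le> integral\<^sup>L M (h k)" for k
    by (intro integral_mono integrable_min int) auto
  then show "\<exists>n0. \<forall>k\<ge>n0. (LINT x|M. min (f x) (h k x)) \<le> integral\<^sup>L M (h k)" by blast
qed

text \<open>
  As one integrand, perimeter and bulk term pass to the limit together.
\<close>

definition energy_density ::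
    "real \<Rightarrow> ('a::euclidean_space \<Rightarrow> real) \<Rightarrow> 'a set \<Rightarrow> 'a set \<Rightarrow> 'a \<Rightarrow> real" where
  "energy_density r g E \<Omega> x =
     1 / (2 * r) * indicator (ball_sum (ess_boundary E) r \<inter> \<Omega>) x + indicator (E \<inter> \<Omega>) x * g x"

lemma open_ball_sum: "open (ball_sum A r)"
  by (auto simp: ball_sum_def)

text \<open>
  Openness of the ball makes membership in \<open>ball_sum A r\<close> stable: it passes from \<open>A\<close> to any set that
  comes close enough to one particular point of \<open>A\<close>. This gives the lower semicontinuity of the perimeter.
\<close>

lemma ball_sum_near:
  assumes "x \<in> ball_sum A r"
  obtains c e where "c \<in> A" "e > 0" "\<And>B. ball c e \<inter> B \<noteq> {} \<Longrightarrow> x \<in> ball_sum B r"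
proof -
  obtain c where c: "c \<in> A" "dist c x < r" using assms by (auto simp: ball_sum_def)
  have "x \<in> ball_sum B r" if meets: "ball c (r - dist c x) \<inter> B \<noteq> {}" for B
  proof -
    obtain y where y: "y \<in> B" "dist c y < r - dist c x" using meets by auto
    have "dist y x < r"
      using y(2) dist_triangle[of y x c] by (simp add: dist_commute)
    then show ?thesis using y(1) by (auto simp: ball_sum_def)
  qed
  then show ?thesis using that[of c "r - dist c x"] c by auto
qed

lemma ae_eq_iff_AE:
  assumes "A \<in> sets lebesgue" "B \<in> sets lebesgue"
  shows "ae_eq A B \<longleftrightarrow> (AE x in lebesgue. x \<in> A \<longleftrightarrow> x \<in> B)"
proof -
  have "(AE x in lebesgue. x \<notin> (A - B) \<union> (B - A)) \<longleftrightarrow> ae_eq A B"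
    using assms unfolding ae_eq_def by (subst AE_iff_null_sets) auto
  moreover have "(\<lambda>x. x \<notin> (A - B) \<union> (B - A)) = (\<lambda>x. x \<in> A \<longleftrightarrow> x \<in> B)" by auto
  ultimately show ?thesis by metis
qed

context
  fixes r :: real and \<Omega> :: "'a::euclidean_space set" and g :: "'a \<Rightarrow> real"
  assumes r: "r > 0" and \<Omega>: "open \<Omega>" "bounded \<Omega>" and g: "locally_integrable g"
begin

lemma set_integrable_domain: "set_integrable lebesgue \<Omega> g"
proof -
  have "set_integrable lebesgue (closure \<Omega>) g"
    using g \<Omega> by (auto simp: locally_integrable_def compact_closure)
  then show ?thesis
    by (rule set_integrable_subset) (use \<Omega> closure_subset in auto)
qed

lemma energy_density_measurable:
  assumes E: "E \<in> sets lebesgue"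
  shows "energy_density r g E \<Omega> \<in> borel_measurable lebesgue"
proof -
  have "ball_sum (ess_boundary E) r \<inter> \<Omega> \<in> sets lebesgue"
    using \<Omega>(1) open_ball_sum[of "ess_boundary E" r] by (auto intro: sets.Int)
  moreover have "set_integrable lebesgue (E \<inter> \<Omega>) g"
    by (rule set_integrable_subset[OF set_integrable_domain]) (use E \<Omega> in auto)
  then have "(\<lambda>x. indicator (E \<inter> \<Omega>) x * g x) \<in> borel_measurable lebesgue"
    by (auto simp: set_integrable_def)
  ultimately show ?thesis
    unfolding energy_density_def by measurable
qed

lemma energy_density_dominated:
  obtains w where "integrable lebesgue w"
    "\<And>E x. \<bar>energy_density r g E \<Omega> x\<bar> \<le> w x"
proof
  have "integrable lebesgue (\<lambda>x. 1 / (2 * r) * indicator \<Omega> x :: real)"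
    using \<Omega> by (intro integrable_mult_right)
      (auto simp: bounded_set_imp_lmeasurable simp flip: lmeasurable_iff_integrable)
  moreover have "integrable lebesgue (\<lambda>x. \<bar>indicator \<Omega> x * g x\<bar>)"
    using set_integrable_domain by (auto simp: set_integrable_def)
  ultimately show "integrable lebesgue (\<lambda>x. 1 / (2 * r) * indicator \<Omega> x + \<bar>indicator \<Omega> x * g x\<bar>)"
    by (rule Bochner_Integration.integrable_add)
  show "\<bar>energy_density r g E \<Omega> x\<bar> \<le> 1 / (2 * r) * indicator \<Omega> x + \<bar>indicator \<Omega> x * g x\<bar>" for E x
  proof -
    have "\<bar>energy_density r g E \<Omega> x\<bar> \<le> \<bar>1 / (2 * r) * indicator (ball_sum (ess_boundary E) r \<inter> \<Omega>) x\<bar>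
        + \<bar>indicator (E \<inter> \<Omega>) x * g x\<bar>"
      unfolding energy_density_def by (rule abs_triangle_ineq)
    also have "\<dots> \<le> 1 / (2 * r) * indicator \<Omega> x + \<bar>indicator \<Omega> x * g x\<bar>"
      by (intro add_mono) (use r in \<open>auto simp: indicator_def\<close>)
    finally show ?thesis .
  qed
qed

lemma integral_energy_density:
  assumes E: "E \<in> sets lebesgue"
  shows "integral\<^sup>L lebesgue (energy_density r g E \<Omega>) = Per_plus r g E \<Omega>"
proof -
  have fm: "ball_sum (ess_boundary E) r \<inter> \<Omega> \<in> lmeasurable"
    using \<Omega> open_ball_sum[of "ess_boundary E" r]
    by (intro bounded_set_imp_lmeasurable) (auto intro: sets.Int bounded_Int)
  have "set_integrable lebesgue (E \<inter> \<Omega>) g"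
    by (rule set_integrable_subset[OF set_integrable_domain]) (use E \<Omega> in auto)
  then have "integrable lebesgue (\<lambda>x. indicator (E \<inter> \<Omega>) x * g x)"
    by (simp add: set_integrable_def)
  moreover have "integrable lebesgue
      (\<lambda>x. 1 / (2 * r) * indicator (ball_sum (ess_boundary E) r \<inter> \<Omega>) x :: real)"
    using fm by (intro integrable_mult_right) (auto simp flip: lmeasurable_iff_integrable)
  ultimately show ?thesis
    unfolding energy_density_def
    by (subst Bochner_Integration.integral_add)
       (auto simp: Per_plus_def Per_def set_lebesgue_integral_def)
qed

text \<open>
  In the set \<open>E\<close> below, the part outside \<open>\<Omega>'\<close> is prescribed; it respects the phases \<open>N\<close> and \<open>P\<close>
  because the minimizing sequence obeys the same constraint. Away from both phases \<open>E\<close> may be chosen freely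
  in \<open>\<Omega>'\<close> without creating essential boundary outside the closed set \<open>- (N \<union> P)\<close>.
\<close>

lemma Per_plus_minimizer:
  assumes E0: "E0 \<in> sets lebesgue" and \<Omega>': "\<Omega>' \<in> sets lebesgue" "\<Omega>' \<subseteq> \<Omega>"
  shows "\<exists>E \<in> sets lebesgue. ae_eq (E - \<Omega>') (E0 - \<Omega>') \<and>
     (\<forall>F \<in> sets lebesgue. ae_eq (F - \<Omega>') (E0 - \<Omega>') \<longrightarrow> Per_plus r g E \<Omega> \<le> Per_plus r g F \<Omega>)"
proof -
  let ?\<phi> = "\<lambda>E. energy_density r g E \<Omega>"
  define \<F> where "\<F> = {F \<in> sets lebesgue. ae_eq (F - \<Omega>') (E0 - \<Omega>')}"
  obtain w where w: "integrable lebesgue w" "\<And>E x. \<bar>?\<phi> E x\<bar> \<le> w x"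
    using energy_density_dominated by blast
  define S where "S = (\<lambda>F. Per_plus r g F \<Omega>) ` \<F>"
  have "E0 \<in> \<F>" using E0 by (simp add: \<F>_def ae_eq_def)
  then have ne: "S \<noteq> {}" by (auto simp: S_def)
  have bb: "bdd_below S"
  proof (rule bdd_belowI)
    fix y assume "y \<in> S"
    then obtain F where F: "F \<in> sets lebesgue" "y = integral\<^sup>L lebesgue (?\<phi> F)"
      by (auto simp: S_def \<F>_def integral_energy_density)
    have "\<bar>y\<bar> \<le> integral\<^sup>L lebesgue w"
      unfolding F(2) real_norm_def[symmetric]
      by (rule order_trans[OF integral_norm_bound])
         (rule integral_mono_AE', use w F in \<open>auto intro: order_trans[OF abs_ge_zero]\<close>)
    then show "- integral\<^sup>L lebesgue w \<le> y" by linarith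
  qed
  obtain v where v: "\<And>k. v k \<in> S" "v \<longlonglongrightarrow> Inf S"
    using closure_contains_Inf[OF ne bb] unfolding closure_sequential by blast
  then have "\<forall>k. \<exists>F. F \<in> \<F> \<and> v k = Per_plus r g F \<Omega>" by (auto simp: S_def)
  then obtain G where G: "\<And>k. G k \<in> \<F>" "\<And>k. v k = Per_plus r g (G k) \<Omega>" by metis
  have Gm: "G k \<in> sets lebesgue" for k using G(1) by (simp add: \<F>_def)
  obtain s N P where s: "strict_mono s" and op: "open N" "open P" and disj: "N \<inter> P = {}"
    and aeN: "AE x in lebesgue. x \<in> N \<longrightarrow> (\<forall>\<^sub>F k in sequentially. x \<notin> G (s k))"
    and aeP: "AE x in lebesgue. x \<in> P \<longrightarrow> (\<forall>\<^sub>F k in sequentially. x \<in> G (s k))"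
    and bd: "\<forall>x e. x \<notin> N \<union> P \<longrightarrow> e > 0 \<longrightarrow>
       (\<forall>\<^sub>F k in sequentially. ball x e \<inter> ess_boundary (G (s k)) \<noteq> {})"
    by (rule subsequence_limit_phases[of G, OF Gm])
  have out: "AE x in lebesgue. \<forall>k. x \<notin> \<Omega>' \<longrightarrow> (x \<in> G (s k) \<longleftrightarrow> x \<in> E0)"
    unfolding AE_all_countable
  proof
    fix k
    have "AE x in lebesgue. x \<in> G (s k) - \<Omega>' \<longleftrightarrow> x \<in> E0 - \<Omega>'"
      using G(1)[of "s k"] E0 \<Omega>' Gm by (subst ae_eq_iff_AE[symmetric]) (auto simp: \<F>_def)
    then show "AE x in lebesgue. x \<notin> \<Omega>' \<longrightarrow> (x \<in> G (s k) \<longleftrightarrow> x \<in> E0)"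
      by eventually_elim auto
  qed
  \<comment> \<open>The factor \<open>indicator \<Omega>\<close> is there for measurability: integrability of \<open>g\<close> is used on \<open>\<Omega>\<close> alone.\<close>
  define H where "H = {x. indicator \<Omega> x * g x < 0}"
  have Hm: "H \<in> sets lebesgue"
  proof -
    have "(\<lambda>x. indicator \<Omega> x * g x) \<in> borel_measurable lebesgue"
      using set_integrable_domain by (auto simp: set_integrable_def)
    then have "{x \<in> space lebesgue. indicator \<Omega> x * g x < 0} \<in> sets lebesgue" by measurable
    then show ?thesis by (simp add: H_def)
  qed
  define E where "E = (E0 - \<Omega>') \<union> (\<Omega>' \<inter> (P \<union> (H - (N \<union> P))))"
  have Em: "E \<in> sets lebesgue"
    using E0 \<Omega>' op Hm unfolding E_def by (intro sets.Un sets.Int sets.Diff) auto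
  have "E - \<Omega>' = E0 - \<Omega>'" by (auto simp: E_def)
  then have EF: "ae_eq (E - \<Omega>') (E0 - \<Omega>')" by (simp add: ae_eq_def)
  have "AE x in lebesgue. x \<notin> N \<inter> E"
    using aeN out
  proof eventually_elim
    case (elim x)
    show ?case
    proof
      assume x: "x \<in> N \<inter> E"
      then have "x \<notin> \<Omega>'" "x \<in> E0" using disj by (auto simp: E_def)
      then show False using elim x by auto
    qed
  qed
  then have "negligible (N \<inter> E)"
    by (rule negligible_if_AE_not_in) (use op Em in auto)
  moreover have "AE x in lebesgue. x \<notin> P - E"
    using aeP out
  proof eventually_elim
    case (elim x)
    show ?case
    proof
      assume x: "x \<in> P - E"
      then have "x \<notin> \<Omega>'" "x \<notin> E0" by (auto simp: E_def)
      then show False using elim x by auto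
    qed
  qed
  then have "negligible (P - E)"
    by (rule negligible_if_AE_not_in) (use op Em in auto)
  ultimately have bE: "ess_boundary E \<subseteq> - (N \<union> P)"
    using ess_boundary_disjoint_open[OF op(1) Em] ess_boundary_disjoint_open[OF op(2) Em] by blast
  have per: "\<forall>\<^sub>F k in sequentially. x \<in> ball_sum (ess_boundary (G (s k))) r"
    if "x \<in> ball_sum (ess_boundary E) r" for x
  proof -
    obtain c e where c: "c \<in> ess_boundary E" "e > 0"
        "\<And>B. ball c e \<inter> B \<noteq> {} \<Longrightarrow> x \<in> ball_sum B r"
      using ball_sum_near[OF \<open>x \<in> ball_sum (ess_boundary E) r\<close>] by blast
    have "\<forall>\<^sub>F k in sequentially. ball c e \<inter> ess_boundary (G (s k)) \<noteq> {}"
      using bd c(1,2) bE by blast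
    then show ?thesis by eventually_elim (rule c(3))
  qed
  have bulk: "AE x in lebesgue. \<forall>\<^sub>F k in sequentially.
      indicator (E \<inter> \<Omega>) x * g x \<le> indicator (G (s k) \<inter> \<Omega>) x * g x"
    using aeN aeP out
  proof eventually_elim
    case (elim x)
    consider "x \<notin> \<Omega>'" | "x \<in> \<Omega>'" "x \<in> N" | "x \<in> \<Omega>'" "x \<in> P" | "x \<in> \<Omega>'" "x \<notin> N \<union> P" by blast
    then show ?case
    proof cases
      case 1
      then show ?thesis using elim by (auto simp: E_def indicator_def)
    next
      case 2
      then have "x \<notin> E" using disj by (auto simp: E_def)
      moreover have "\<forall>\<^sub>F k in sequentially. x \<notin> G (s k)" using elim 2 by blast
      ultimately show ?thesis by (auto elim!: eventually_mono)
    next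
      case 3
      then have "x \<in> E" by (auto simp: E_def)
      have "\<forall>\<^sub>F k in sequentially. x \<in> G (s k)" using elim 3 by blast
      then show ?thesis by eventually_elim (simp add: indicator_def \<open>x \<in> E\<close>)
    next
      case 4
      then have "x \<in> E \<longleftrightarrow> g x < 0" "x \<in> \<Omega>" using \<Omega>' by (auto simp: E_def H_def indicator_def)
      then show ?thesis by (auto simp: indicator_def)
    qed
  qed
  have le: "AE x in lebesgue. \<forall>\<^sub>F k in sequentially. ?\<phi> E x \<le> ?\<phi> (G (s k)) x"
    using bulk
  proof eventually_elim
    case (elim x)
    have "\<forall>\<^sub>F k in sequentially. (indicator (ball_sum (ess_boundary E) r \<inter> \<Omega>) x :: real)
        \<le> indicator (ball_sum (ess_boundary (G (s k))) r \<inter> \<Omega>) x"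
    proof (cases "x \<in> ball_sum (ess_boundary E) r")
      case True
      from per[OF this] show ?thesis by eventually_elim (simp add: indicator_def)
    qed simp
    with elim show ?case
      by eventually_elim (use r in \<open>auto simp: energy_density_def intro!: add_mono divide_right_mono\<close>)
  qed
  have "(\<lambda>k. integral\<^sup>L lebesgue (?\<phi> (G (s k)))) \<longlonglongrightarrow> Inf S"
    using LIMSEQ_subseq_LIMSEQ[OF v(2) s] by (simp add: integral_energy_density Gm G(2) o_def)
  then have "integral\<^sup>L lebesgue (?\<phi> E) \<le> Inf S"
    by (intro integral_le_limit_if_eventually_le[OF w(1) _ w(2) _ w(2) le] energy_density_measurable Em Gm)
  then have "Per_plus r g E \<Omega> \<le> Inf S" by (simp add: integral_energy_density Em)
  then have "Per_plus r g E \<Omega> \<le> Per_plus r g F \<Omega>"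
    if "F \<in> sets lebesgue" "ae_eq (F - \<Omega>') (E0 - \<Omega>')" for F
    using cInf_lower[OF _ bb, of "Per_plus r g F \<Omega>"] that by (force simp: S_def \<F>_def)
  with Em EF show ?thesis by blast
qed

end

theorem theorem1p9:
  fixes r :: real and E\<^sub>o \<Omega> \<Omega>' :: "(real ^ 'n) set"
  assumes "r > 0"
    and "E\<^sub>o \<in> sets lebesgue"
    and "open \<Omega>" and "bounded \<Omega>"
    and "\<Omega>' \<in> sets lebesgue" and "compactly_inside \<Omega>' \<Omega>"
  shows "(\<exists>E \<in> sets lebesgue. ae_eq (E - \<Omega>') (E\<^sub>o - \<Omega>') \<and>
            (\<forall>F \<in> sets lebesgue. ae_eq (F - \<Omega>') (E\<^sub>o - \<Omega>') \<longrightarrow> Per r E \<Omega> \<le> Per r F \<Omega>)) \<and>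
         (\<forall>g :: real ^ 'n \<Rightarrow> real. locally_integrable g \<longrightarrow>
            (\<exists>E \<in> sets lebesgue. ae_eq (E - \<Omega>') (E\<^sub>o - \<Omega>') \<and>
               (\<forall>F \<in> sets lebesgue. ae_eq (F - \<Omega>') (E\<^sub>o - \<Omega>') \<longrightarrow>
                  Per_plus r g E \<Omega> \<le> Per_plus r g F \<Omega>)))"
proof -
  have sub: "\<Omega>' \<subseteq> \<Omega>"
    using assms(6) closure_subset[of \<Omega>'] by (auto simp: compactly_inside_def)
  note minimizer = Per_plus_minimizer[OF assms(1,3,4) _ assms(2,5) sub]
  have "locally_integrable (\<lambda>_ :: real ^ 'n. 0)"
    by (simp add: locally_integrable_def set_integrable_def)
  from minimizer[OF this] have "\<exists>E \<in> sets lebesgue. ae_eq (E - \<Omega>') (E\<^sub>o - \<Omega>') \<and>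
            (\<forall>F \<in> sets lebesgue. ae_eq (F - \<Omega>') (E\<^sub>o - \<Omega>') \<longrightarrow> Per r E \<Omega> \<le> Per r F \<Omega>)"
    by (simp add: Per_plus_def)
  with minimizer show ?thesis by blast
qed

end
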